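(* Let $n\ge 2$ be an integer, $L=\binom{n}{2}$, and let $H\in\mathbb{R}^{L\times L}$ be the inner product matrix with entries $H_{\alpha,\beta}=\langle w_\alpha,w_\beta\rangle$, $\alpha,\beta\in\mathbb{I}$. Then $$H = 4 I_L + \mathcal{A}(\mathcal{T}_n),$$ where $\mathcal{A}(\mathcal{T}_n)$ is the adjacency matrix of the triangular graph $\mathcal{T}_n$, with the vertex $v_{i,j}$ of $\mathcal{T}_n$ identified with the index $(i,j)\in\mathbb{I}$.
   Context: Let $\mathbb{I}=\{(i,j):1\le i<j\le n\}$, which has size $L=n(n-1)/2$. Let $e_{i,j}\in\mathbb{R}^{n\times n}$ be the matrix whose only nonzero entry is a $1$ at position $(i,j)$. For $\alpha=(\alpha_1,\alpha_2)\in\mathbb{I}$ define $w_\alpha=e_{\alpha_1,\alpha_1}+e_{\alpha_2,\alpha_2}-e_{\alpha_1,\alpha_2}-e_{\alpha_2,\alpha_1}$. $\langle X,Y\rangle=\operatorname{trace}(X^\top Y)$ is the trace inner product, and $I_L$ is the $L\times L$ identity matrix. The triangular graph $\mathcal{T}_n$ is formed from the complete graph $\mathcal{K}_n$ on vertices $\{1,\dots,n\}$: it has one vertex $v_{i,j}$ for each edge $\{i,j\}$ ($i<j$) of $\mathcal{K}_n$, and two distinct vertices $v_{i,j},v_{k,l}$ are adjacent if and only if the corresponding edges share a common vertex in $\mathcal{K}_n$. *)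

theory Defs
  imports "Jordan_Normal_Form.Matrix" "Graph_Theory.Kuratowski"
begin

definition index_pairs :: "nat \<Rightarrow> (nat \<times> nat) set" where
  "index_pairs n = {(i, j). 1 \<le> i \<and> i < j \<and> j \<le> n}"

text \<open>The indices \<open>i\<close>, \<open>j\<close> range over \<open>1..n\<close>, whereas the library counts rows and columns of a
  matrix from \<open>0\<close>; hence the shift.\<close>

definition unit_mat :: "nat \<Rightarrow> nat \<Rightarrow> nat \<Rightarrow> real mat" where
  "unit_mat n i j = mat n n (\<lambda>(r, c). if r + 1 = i \<and> c + 1 = j then 1 else 0)"

definition basis_mat :: "nat \<Rightarrow> nat \<times> nat \<Rightarrow> real mat" where
  "basis_mat n \<alpha> = unit_mat n (fst \<alpha>) (fst \<alpha>) + unit_mat n (snd \<alpha>) (snd \<alpha>)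
     - unit_mat n (fst \<alpha>) (snd \<alpha>) - unit_mat n (snd \<alpha>) (fst \<alpha>)"

definition mat_trace :: "'a::comm_monoid_add mat \<Rightarrow> 'a" where
  "mat_trace A = (\<Sum>i<dim_row A. A $$ (i, i))"

definition trace_inner :: "real mat \<Rightarrow> real mat \<Rightarrow> real" where
  "trace_inner X Y = mat_trace (transpose_mat X * Y)"

text \<open>Undirected graphs are symmetric digraphs, so \<open>parcs\<close> contains both orientations of every edge.\<close>

definition complete_graph :: "nat \<Rightarrow> nat pair_pre_digraph" where
  "complete_graph n = \<lparr> pverts = {1..n}, parcs = {(u, v). u \<in> {1..n} \<and> v \<in> {1..n} \<and> u \<noteq> v} \<rparr>"

definition triangular_verts :: "nat \<Rightarrow> (nat \<times> nat) set" where
  "triangular_verts n = {(i, j). (i, j) \<in> parcs (complete_graph n) \<and> i < j}"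

definition triangular_graph :: "nat \<Rightarrow> (nat \<times> nat) pair_pre_digraph" where
  "triangular_graph n =
    \<lparr> pverts = triangular_verts n,
      parcs = {(v, w). v \<in> triangular_verts n \<and> w \<in> triangular_verts n \<and> v \<noteq> w
                 \<and> {fst v, snd v} \<inter> {fst w, snd w} \<noteq> {}} \<rparr>"

text \<open>The rows and columns are ordered by an enumeration \<open>idx\<close> of the vertices, which is meant to be
  a bijection from \<open>{..<card (verts G)}\<close> onto \<open>verts G\<close>.\<close>

definition adjacency_matrix :: "('v, 'e) pre_digraph \<Rightarrow> (nat \<Rightarrow> 'v) \<Rightarrow> real mat" where
  "adjacency_matrix G idx =
     mat (card (verts G)) (card (verts G))
       (\<lambda>(a, b). if idx a \<rightarrow>\<^bsub>G\<^esub> idx b then 1 else 0)"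

lemma complete_graph_complete: "complete_digraph n (with_proj (complete_graph n))"
  by (auto simp: complete_digraph_pair_def complete_graph_def)

lemma triangular_verts_eq: "triangular_verts n = index_pairs n"
  by (auto simp: triangular_verts_def complete_graph_def index_pairs_def)

lemma finite_index_pairs: "finite (index_pairs n)"
  by (rule finite_subset[of _ "{1..n} \<times> {1..n}"]) (auto simp: index_pairs_def)

lemma triangular_graph_pair_graph: "pair_graph (triangular_graph n)"
proof -
  have "finite (parcs (triangular_graph n))"
    by (rule finite_subset[of _ "index_pairs n \<times> index_pairs n"])
      (auto simp: triangular_graph_def triangular_verts_eq finite_index_pairs)
  then show ?thesis
    by unfold_locales
      (auto simp: triangular_graph_def triangular_verts_eq finite_index_pairs symmetric_def sym_def)
qed

lemma card_index_pairs: "card (index_pairs n) = n choose 2"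
proof (induction n)
  case 0
  have "index_pairs 0 = {}" by (auto simp: index_pairs_def)
  then show ?case by simp
next
  case (Suc n)
  have eq: "index_pairs (Suc n) = index_pairs n \<union> (\<lambda>i. (i, Suc n)) ` {1..n}"
    by (auto simp: index_pairs_def)
  have "card (index_pairs (Suc n)) = card (index_pairs n) + card ((\<lambda>i. (i, Suc n)) ` {1..n})"
    unfolding eq by (rule card_Un_disjoint) (auto simp: finite_index_pairs, auto simp: index_pairs_def)
  also have "card ((\<lambda>i. (i, Suc n)) ` {1..n}) = n"
    by (subst card_image) (auto simp: inj_on_def)
  finally show ?case using Suc.IH by (simp add: numeral_2_eq_2)
qed

lemma ex_enumeration: "\<exists>idx. bij_betw idx {..<n choose 2} (index_pairs n)"
  using ex_bij_betw_nat_finite[OF finite_index_pairs[of n]]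
  by (simp add: card_index_pairs atLeast0LessThan)

end

theory Submission
  imports Defs
begin

text \<open>Each \<open>w\<^sub>\<alpha>\<close> is the rank-one matrix \<open>x\<^sub>\<alpha> x\<^sub>\<alpha>\<^sup>T\<close>, where \<open>x\<^sub>\<alpha>\<close> is the signed incidence vector of
  the edge \<open>\<alpha>\<close> of the complete graph (lemma \<open>basis_mat_rank_one\<close>), so the trace inner product of
  two of them is the square of the dot product of the vectors (lemma \<open>trace_inner_basis_mat\<close>).
  That dot product is \<open>2\<close> for equal edges, \<open>1\<close> or \<open>-1\<close> for distinct edges with a common endpoint,
  and \<open>0\<close> for disjoint edges. Squaring removes the sign, leaving \<open>4\<close> on the diagonal and the
  adjacency indicator of the triangular graph elsewhere.\<close>

text \<open>Matrix rows start at \<open>0\<close> and graph vertices at \<open>1\<close>, so coordinate \<open>r\<close> belongs to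
  vertex \<open>r + 1\<close>.\<close>

definition incidence_vec :: "nat \<times> nat \<Rightarrow> nat \<Rightarrow> real" where
  "incidence_vec \<alpha> r = of_bool (r + 1 = fst \<alpha>) - of_bool (r + 1 = snd \<alpha>)"

lemma basis_mat_dim [simp]:
  "dim_row (basis_mat n \<alpha>) = n" "dim_col (basis_mat n \<alpha>) = n"
  by (simp_all add: basis_mat_def unit_mat_def)

lemma unit_mat_dim [simp]:
  "dim_row (unit_mat n i j) = n" "dim_col (unit_mat n i j) = n"
  by (simp_all add: unit_mat_def)

lemma unit_mat_index:
  assumes "r < n" "c < n"
  shows "unit_mat n i j $$ (r, c) = of_bool (r + 1 = i) * of_bool (c + 1 = j)"
  using assms by (simp add: unit_mat_def)

lemma basis_mat_rank_one:
  assumes "r < n" "c < n"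
  shows "basis_mat n \<alpha> $$ (r, c) = incidence_vec \<alpha> r * incidence_vec \<alpha> c"
proof -
  have "basis_mat n \<alpha> $$ (r, c) =
      unit_mat n (fst \<alpha>) (fst \<alpha>) $$ (r, c) + unit_mat n (snd \<alpha>) (snd \<alpha>) $$ (r, c)
      - unit_mat n (fst \<alpha>) (snd \<alpha>) $$ (r, c) - unit_mat n (snd \<alpha>) (fst \<alpha>) $$ (r, c)"
    using assms by (simp add: basis_mat_def)
  then show ?thesis
    unfolding unit_mat_index[OF assms] incidence_vec_def
    by (simp only: left_diff_distrib right_diff_distrib)
qed

text \<open>The double sum over matrix entries factors because both matrices have rank one.\<close>

lemma trace_inner_basis_mat:
  "trace_inner (basis_mat n \<alpha>) (basis_mat n \<beta>) =
    (\<Sum>r<n. incidence_vec \<alpha> r * incidence_vec \<beta> r)\<^sup>2"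
proof -
  have "trace_inner (basis_mat n \<alpha>) (basis_mat n \<beta>) =
      (\<Sum>c<n. \<Sum>r<n. basis_mat n \<alpha> $$ (r, c) * basis_mat n \<beta> $$ (r, c))"
    by (simp add: trace_inner_def mat_trace_def scalar_prod_def atLeast0LessThan)
  also have "\<dots> = (\<Sum>c<n. \<Sum>r<n. (incidence_vec \<alpha> c * incidence_vec \<beta> c) *
      (incidence_vec \<alpha> r * incidence_vec \<beta> r))"
    by (intro sum.cong refl) (simp add: basis_mat_rank_one)
  also have "\<dots> = (\<Sum>r<n. incidence_vec \<alpha> r * incidence_vec \<beta> r)\<^sup>2"
    by (simp add: power2_eq_square sum_product)
  finally show ?thesis .
qed

lemma incidence_vec_dot:
  assumes "fst \<alpha> \<in> {1..n}" "snd \<alpha> \<in> {1..n}"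
  shows "(\<Sum>r<n. incidence_vec \<alpha> r * incidence_vec \<beta> r) =
    of_bool (fst \<alpha> = fst \<beta>) - of_bool (fst \<alpha> = snd \<beta>)
      - of_bool (snd \<alpha> = fst \<beta>) + of_bool (snd \<alpha> = snd \<beta>)"
proof -
  have pick: "(\<Sum>r<n. of_bool (r + 1 = i) * f r) = f (i - 1)" if "i \<in> {1..n}"
    for i and f :: "nat \<Rightarrow> real"
  proof -
    have "1 \<le> i" "i \<le> n"
      using that by simp_all
    then have "i - 1 < n" and "r + 1 = i \<longleftrightarrow> r = i - 1" for r
      by linarith+
    then have "(\<Sum>r<n. of_bool (r + 1 = i) * f r) = (\<Sum>r<n. if r = i - 1 then f r else 0)"
      by (intro sum.cong refl) simp
    also have "\<dots> = f (i - 1)"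
      using \<open>i - 1 < n\<close> by (simp only: sum.delta finite_lessThan lessThan_iff if_True)
    finally show ?thesis .
  qed
  have shift: "fst \<alpha> - 1 + 1 = fst \<alpha>" "snd \<alpha> - 1 + 1 = snd \<alpha>"
    using assms by simp_all
  have "(\<Sum>r<n. incidence_vec \<alpha> r * incidence_vec \<beta> r) =
      (\<Sum>r<n. of_bool (r + 1 = fst \<alpha>) * incidence_vec \<beta> r) -
      (\<Sum>r<n. of_bool (r + 1 = snd \<alpha>) * incidence_vec \<beta> r)"
    unfolding incidence_vec_def[of \<alpha>] by (simp only: left_diff_distrib sum_subtractf)
  also have "\<dots> = incidence_vec \<beta> (fst \<alpha> - 1) - incidence_vec \<beta> (snd \<alpha> - 1)"
    by (simp only: pick[OF assms(1)] pick[OF assms(2)])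
  also have "\<dots> = of_bool (fst \<alpha> = fst \<beta>) - of_bool (fst \<alpha> = snd \<beta>)
      - of_bool (snd \<alpha> = fst \<beta>) + of_bool (snd \<alpha> = snd \<beta>)"
    unfolding incidence_vec_def shift by (simp only: diff_diff_eq2 diff_add_eq)
  finally show ?thesis .
qed

text \<open>Because both pairs are increasing, for equal edges exactly the two comparisons with sign \<open>+\<close>
  hold, and for distinct edges at most one of the four comparisons holds. So the signed sum is \<open>2\<close>
  in the first case and lies in \<open>{-1, 0, 1}\<close> in the second.\<close>

lemma edge_overlap_square:
  fixes i j k l :: nat
  assumes "i < j" "k < l"
  shows "(of_bool (i = k) - of_bool (i = l) - of_bool (j = k) + of_bool (j = l) :: real)\<^sup>2 =
    (if i = k \<and> j = l then 4 else of_bool ({i, j} \<inter> {k, l} \<noteq> {}))"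
  using assms by (cases "i = k"; cases "i = l"; cases "j = k"; cases "j = l"; simp)

lemma trace_inner_index_pairs:
  assumes "\<alpha> \<in> index_pairs n" "\<beta> \<in> index_pairs n"
  shows "trace_inner (basis_mat n \<alpha>) (basis_mat n \<beta>) =
    (if \<alpha> = \<beta> then 4 else of_bool ({fst \<alpha>, snd \<alpha>} \<inter> {fst \<beta>, snd \<beta>} \<noteq> {}))"
proof -
  have "fst \<alpha> \<in> {1..n}" "snd \<alpha> \<in> {1..n}"
    using assms(1) by (auto simp: index_pairs_def)
  note inner = trace_inner_basis_mat[of n \<alpha> \<beta>, unfolded incidence_vec_dot[OF this]]
  have "fst \<alpha> < snd \<alpha>" "fst \<beta> < snd \<beta>"
    using assms by (auto simp: index_pairs_def)
  then show ?thesis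
    unfolding inner prod_eq_iff by (rule edge_overlap_square)
qed

lemma triangular_graph_adj:
  assumes "\<alpha> \<in> index_pairs n" "\<beta> \<in> index_pairs n"
  shows "\<alpha> \<rightarrow>\<^bsub>with_proj (triangular_graph n)\<^esub> \<beta> \<longleftrightarrow>
    \<alpha> \<noteq> \<beta> \<and> {fst \<alpha>, snd \<alpha>} \<inter> {fst \<beta>, snd \<beta>} \<noteq> {}"
proof -
  have "\<alpha> \<rightarrow>\<^bsub>with_proj (triangular_graph n)\<^esub> \<beta> \<longleftrightarrow> (\<alpha>, \<beta>) \<in> parcs (triangular_graph n)"
    by simp
  then show ?thesis
    using assms unfolding triangular_graph_def triangular_verts_eq by simp
qed

theorem claim1:
  fixes n L :: nat and idx :: "nat \<Rightarrow> nat \<times> nat" and H :: "real mat"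
  assumes "n \<ge> 2"
    and "L = n choose 2"
    and "bij_betw idx {..<L} (index_pairs n)"
    and "H = mat L L (\<lambda>(a, b). trace_inner (basis_mat n (idx a)) (basis_mat n (idx b)))"
  shows "H = 4 \<cdot>\<^sub>m 1\<^sub>m L + adjacency_matrix (with_proj (triangular_graph n)) idx"
proof -
  let ?A = "adjacency_matrix (with_proj (triangular_graph n)) idx"
  have "card (verts (with_proj (triangular_graph n))) = L"
    using assms(2) by (simp add: triangular_graph_def triangular_verts_eq card_index_pairs)
  then have A: "?A = mat L L (\<lambda>(a, b).
      if idx a \<rightarrow>\<^bsub>with_proj (triangular_graph n)\<^esub> idx b then 1 else 0)"
    by (simp only: adjacency_matrix_def)
  have entry: "trace_inner (basis_mat n (idx a)) (basis_mat n (idx b)) =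
      4 * (if a = b then 1 else 0) +
      (if idx a \<rightarrow>\<^bsub>with_proj (triangular_graph n)\<^esub> idx b then 1 else 0)"
    if "a < L" "b < L" for a b
  proof -
    have mem: "idx a \<in> index_pairs n" "idx b \<in> index_pairs n"
      using that assms(3) by (auto dest: bij_betwE)
    have inj: "idx a = idx b \<longleftrightarrow> a = b"
      using that assms(3) by (auto simp: bij_betw_def inj_on_eq_iff)
    show ?thesis
      unfolding trace_inner_index_pairs[OF mem] triangular_graph_adj[OF mem] inj
      by (cases "a = b"; simp only: simp_thms if_True if_False of_bool_def; simp)
  qed
  show ?thesis
    unfolding assms(4) A by (rule eq_matI) (simp_all add: entry del: with_proj_simps)
qed

end
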